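(* Let $A\in\mathbb{R}^{n\times n}$ be symmetric and indefinite, $a,b\in\mathbb{R}^n$ and $\beta\in\mathbb{R}$. Suppose there exists $\bar x\in\mathbb{R}^n$ with $\|\bar x\|^2-1<0$ and $b^T\bar x-\beta<0$. Let $$S=\{(u_0;u)\in\mathbb{R}\times\mathbb{R}^n:\ u^Tx-u_0\ge 0\ \text{ for all } x\in\mathbb{R}^n \text{ with } \|x\|^2\le 1\}.$$ Then $$\min\{x^TAx+2a^Tx:\ \|x\|^2\le 1,\ b^Tx\le\beta\}=\max_{\lambda_0\ge 0,\ (u_0;u)\in S}\ \inf_{x\in\mathbb{R}^n}\Big\{x^TAx+2a^Tx+\lambda_0(\|x\|^2-1)+(u^Tx-u_0)(b^Tx-\beta)\Big\},$$ and the maximum on the right-hand side is attained.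
   Context: $\|\cdot\|$ is the Euclidean norm. The inner infimum is over all of $\mathbb{R}^n$, takes values in $[-\infty,\infty)$, and the outer maximization is over $\lambda_0\in\mathbb{R}$, $u_0\in\mathbb{R}$, $u\in\mathbb{R}^n$ satisfying the displayed constraints. *)

theory Defs
  imports "HOL-Analysis.Analysis"
begin

definition symmetric_matrix :: "real^'n^'n \<Rightarrow> bool" where
  "symmetric_matrix A \<longleftrightarrow> transpose A = A"

text \<open>Indefinite: neither positive nor negative semidefinite.\<close>

definition indefinite_matrix :: "real^'n^'n \<Rightarrow> bool" where
  "indefinite_matrix A \<longleftrightarrow> (\<exists>x. x \<bullet> (A *v x) > 0) \<and> (\<exists>x. x \<bullet> (A *v x) < 0)"

definition objective :: "real^'n^'n \<Rightarrow> real^'n \<Rightarrow> real^'n \<Rightarrow> real" where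
  "objective A a x = x \<bullet> (A *v x) + 2 * (a \<bullet> x)"

definition feasible_set :: "real^'n \<Rightarrow> real \<Rightarrow> (real^'n) set" where
  "feasible_set b \<beta> = {x. (norm x)\<^sup>2 \<le> 1 \<and> b \<bullet> x \<le> \<beta>}"

definition multiplier_set :: "(real \<times> (real^'n)) set" where
  "multiplier_set = {(u0, u). \<forall>x. (norm x)\<^sup>2 \<le> 1 \<longrightarrow> u \<bullet> x - u0 \<ge> 0}"

definition dual_feasible_set :: "(real \<times> real \<times> (real^'n)) set" where
  "dual_feasible_set = {(l0, u0, u). l0 \<ge> 0 \<and> (u0, u) \<in> multiplier_set}"

text \<open>The multiplier of the linear constraint is the affine function
  \<open>u \<bullet> x - u0\<close> of \<open>x\<close> rather than a constant.\<close>

definition lagrangian ::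
  "real^'n^'n \<Rightarrow> real^'n \<Rightarrow> real^'n \<Rightarrow> real \<Rightarrow> real \<Rightarrow> real \<Rightarrow> real^'n \<Rightarrow> real^'n \<Rightarrow> real" where
  "lagrangian A a b \<beta> l0 u0 u x =
     x \<bullet> (A *v x) + 2 * (a \<bullet> x) + l0 * ((norm x)\<^sup>2 - 1) + (u \<bullet> x - u0) * (b \<bullet> x - \<beta>)"

text \<open>Valued in \<^typ>\<open>ereal\<close> because the infimum over the whole space may be \<open>-\<infinity>\<close>.\<close>

definition dual_function ::
  "real^'n^'n \<Rightarrow> real^'n \<Rightarrow> real^'n \<Rightarrow> real \<Rightarrow> real \<times> real \<times> (real^'n) \<Rightarrow> ereal" where
  "dual_function A a b \<beta> = (\<lambda>(l0, u0, u). INF x. ereal (lagrangian A a b \<beta> l0 u0 u x))"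

end

theory Submission
  imports Defs "HOL-Library.Multiset"
begin

text \<open>
  Homogenise with \<open>z = (t, x)\<close>. Put \<open>J z = t\<^sup>2 - (norm x)\<^sup>2\<close> and
  \<open>\<ell> z = \<beta> * t - b \<bullet> x\<close>, and let \<open>Q\<close> be the form of the objective minus its minimum, so that
  \<open>Q\<close> is nonnegative on the second-order cone intersected with \<open>\<ell> \<ge> 0\<close>. Optimal multipliers are a
  number \<open>l \<ge> 0\<close> and a vector \<open>c\<close> in the dual cone with \<open>Q z \<ge> l * J z + (c \<bullet> z) * \<ell> z\<close> for all \<open>z\<close>.
  They are the coefficients of a hyperplane separating the convex cone of all finite sums of
  vectors \<open>(J z, \<ell> z *\<^sub>R z, Q z)\<close> from \<open>{0..} \<times> second-order cone \<times> {..<0}\<close>; the Slater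
  point keeps the coefficient of \<open>Q\<close> from vanishing. That the two sets are disjoint is the
  rank-one decomposition of Sturm and Zhang: a plane rotation of two summands changes neither
  such a sum nor the number of summands, and by rotations every summand can be moved into the
  region where \<open>Q\<close> is known to be nonnegative.
\<close>

section \<open>Plane rotations of sums of squares\<close>

text \<open>The substitution is orthogonal in the pair \<open>x, y\<close>, so the mixed terms of
  the two squares cancel.\<close>

lemma bilinear_rotation:
  assumes "bilinear B" "c\<^sup>2 + s\<^sup>2 = (1::real)"
  shows "B (c *\<^sub>R x + s *\<^sub>R y) (c *\<^sub>R x + s *\<^sub>R y) + B (s *\<^sub>R x - c *\<^sub>R y) (s *\<^sub>R x - c *\<^sub>R y)
    = B x x + B y y"
proof -
  have "B (c *\<^sub>R x + s *\<^sub>R y) (c *\<^sub>R x + s *\<^sub>R y) + B (s *\<^sub>R x - c *\<^sub>R y) (s *\<^sub>R x - c *\<^sub>R y)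
    = (c\<^sup>2 + s\<^sup>2) *\<^sub>R B x x + (c\<^sup>2 + s\<^sup>2) *\<^sub>R B y y"
    using assms(1)
    by (simp add: bilinear_ladd bilinear_radd bilinear_lsub bilinear_rsub bilinear_lmul
        bilinear_rmul power2_eq_square algebra_simps)
  then show ?thesis
    using assms(2) by simp
qed

text \<open>Intermediate value theorem on the quarter circle from \<open>x\<close> to
  \<open>y\<close>. Neither end is a zero, so both coefficients are strictly positive; their signs
  later decide on which sheet of the cone a rotated vector lies.\<close>

lemma rotate_to_isotropic:
  fixes B :: "'a::real_vector \<Rightarrow> 'a \<Rightarrow> real"
  assumes "bilinear B" "B x x > 0" "B y y < 0"
  obtains c s where "c > 0" "s > 0" "c\<^sup>2 + s\<^sup>2 = 1"
    "B (c *\<^sub>R x + s *\<^sub>R y) (c *\<^sub>R x + s *\<^sub>R y) = 0"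
proof -
  define f where "f \<theta> = B (cos \<theta> *\<^sub>R x + sin \<theta> *\<^sub>R y) (cos \<theta> *\<^sub>R x + sin \<theta> *\<^sub>R y)" for \<theta>
  have f_eq: "f \<theta> = (cos \<theta>)\<^sup>2 * B x x + cos \<theta> * sin \<theta> * (B x y + B y x) + (sin \<theta>)\<^sup>2 * B y y" for \<theta>
    using assms(1) unfolding f_def
    by (simp add: bilinear_ladd bilinear_radd bilinear_lmul bilinear_rmul power2_eq_square algebra_simps)
  have "continuous_on {0..pi/2} f"
    unfolding f_eq by (intro continuous_intros)
  then obtain \<theta> where \<theta>: "0 \<le> \<theta>" "\<theta> \<le> pi/2" "f \<theta> = 0"
    using IVT2'[of f "pi/2" 0 0] assms by (auto simp: f_eq)
  have "f 0 > 0" "f (pi/2) < 0"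
    using assms by (simp_all add: f_eq)
  then have "\<theta> \<noteq> 0" "\<theta> \<noteq> pi/2"
    using \<theta>(3) by (metis less_irrefl)+
  with \<theta> have "0 < \<theta>" "\<theta> < pi/2" by auto
  then have "cos \<theta> > 0" "sin \<theta> > 0"
    by (auto intro: cos_gt_zero sin_gt_zero2)
  then show ?thesis
    using that[of "cos \<theta>" "sin \<theta>"] \<theta>(3) by (simp add: f_def)
qed

text \<open>Rotations concentrate \<open>\<phi>\<close> on the single vector \<open>w\<close>. For
  the triple of the separation argument, the component \<open>\<phi> z *\<^sub>R z\<close> of the
  whole sum then comes from \<open>w\<close> alone.\<close>

lemma sum_squares_split_kernel:
  fixes \<phi> :: "'a::real_vector \<Rightarrow> real" and B :: "'a \<Rightarrow> 'a \<Rightarrow> 'b::real_vector"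
  assumes "bilinear B" "linear \<phi>"
  shows "\<exists>w N. \<phi> w \<ge> 0 \<and> (\<forall>x\<in>#N. \<phi> x = 0) \<and> (\<Sum>z\<in>#M. B z z) = B w w + (\<Sum>x\<in>#N. B x x)"
proof (induction M)
  case empty
  show ?case
    by (rule exI[of _ 0], rule exI[of _ "{#}"])
      (simp add: bilinear_lzero[OF assms(1)] linear_0[OF assms(2)])
next
  case (add z M)
  then obtain w N where w: "\<phi> w \<ge> 0" and N: "\<forall>x\<in>#N. \<phi> x = 0"
    and eq: "(\<Sum>z\<in>#M. B z z) = B w w + (\<Sum>x\<in>#N. B x x)" by blast
  show ?case
  proof (cases "\<phi> z = 0")
    case True
    then show ?thesis
      using w N eq by (intro exI[of _ w] exI[of _ "add_mset z N"]) auto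
  next
    case False
    define r where "r = sqrt ((\<phi> w)\<^sup>2 + (\<phi> z)\<^sup>2)"
    have r2: "r\<^sup>2 = (\<phi> w)\<^sup>2 + (\<phi> z)\<^sup>2"
      by (simp add: r_def)
    have r: "r > 0"
      using False by (simp add: r_def sum_power2_gt_zero_iff)
    \<comment> \<open>The rotation that turns the pair \<open>(\<phi> w, \<phi> z)\<close> into
      \<open>(r, 0)\<close>.\<close>
    define c s where "c = \<phi> w / r" and "s = \<phi> z / r"
    have cs: "c\<^sup>2 + s\<^sup>2 = 1"
      using r by (simp add: c_def s_def power_divide r2[symmetric] flip: add_divide_distrib)
    have "\<phi> (c *\<^sub>R w + s *\<^sub>R z) = r * (c\<^sup>2 + s\<^sup>2)"
      using assms(2) r by (simp add: linear_add linear_scale c_def s_def power2_eq_square field_simps)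
    then have "\<phi> (c *\<^sub>R w + s *\<^sub>R z) \<ge> 0"
      using r cs by simp
    moreover have "\<phi> (s *\<^sub>R w - c *\<^sub>R z) = 0"
      using assms(2) by (simp add: linear_diff linear_scale c_def s_def)
    ultimately show ?thesis
      using N eq bilinear_rotation[OF assms(1) cs, of w z]
      by (intro exI[of _ "c *\<^sub>R w + s *\<^sub>R z"] exI[of _ "add_mset (s *\<^sub>R w - c *\<^sub>R z) N"])
        (auto simp: algebra_simps)
  qed
qed

section \<open>The second-order cone\<close>

text \<open>The polar form of \<open>J\<close> from the overview, so that the rotation lemmas apply
  to it.\<close>

definition lorentz :: "real \<times> 'a::real_inner \<Rightarrow> real \<times> 'a \<Rightarrow> real" where
  "lorentz z w = fst z * fst w - snd z \<bullet> snd w"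

definition second_order_cone :: "(real \<times> 'a::real_normed_vector) set" where
  "second_order_cone = {z. norm (snd z) \<le> fst z}"

lemma bilinear_lorentz: "bilinear lorentz"
  unfolding bilinear_def lorentz_def
  by (auto intro!: linearI simp: algebra_simps inner_add_left inner_add_right)

lemma lorentz_self: "lorentz z z = (fst z)\<^sup>2 - (norm (snd z))\<^sup>2"
  by (simp add: lorentz_def power2_eq_square dot_square_norm)

lemma lorentz_nonneg_iff: "lorentz z z \<ge> 0 \<longleftrightarrow> z \<in> second_order_cone \<or> - z \<in> second_order_cone"
proof -
  have "lorentz z z \<ge> 0 \<longleftrightarrow> norm (snd z) \<le> \<bar>fst z\<bar>"
    using abs_le_square_iff[of "norm (snd z)" "fst z"] by (simp add: lorentz_self)
  also have "\<dots> \<longleftrightarrow> norm (snd z) \<le> fst z \<or> norm (snd z) \<le> - fst z"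
    by linarith
  finally show ?thesis
    by (simp add: second_order_cone_def)
qed

lemma second_order_cone_0: "0 \<in> second_order_cone"
  by (simp add: second_order_cone_def)

lemma second_order_cone_scaleR:
  "z \<in> second_order_cone \<Longrightarrow> 0 \<le> r \<Longrightarrow> r *\<^sub>R z \<in> second_order_cone"
  by (simp add: second_order_cone_def mult_left_mono)

lemma second_order_cone_add:
  "z \<in> second_order_cone \<Longrightarrow> w \<in> second_order_cone \<Longrightarrow> z + w \<in> second_order_cone"
  by (auto simp: second_order_cone_def intro: order.trans[OF norm_triangle_ineq])

lemma convex_second_order_cone: "convex second_order_cone"
  by (rule convexI) (simp add: second_order_cone_add second_order_cone_scaleR)

text \<open>Otherwise \<open>\<tau> *\<^sub>R x\<close> would be, up to sign, a sum of two elements of the cone.\<close>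

lemma second_order_cone_same_sheet:
  assumes w: "w \<in> second_order_cone" and "\<alpha> \<ge> 0" and x: "lorentz x x < 0"
    and nonneg: "lorentz (\<alpha> *\<^sub>R w + \<tau> *\<^sub>R x) (\<alpha> *\<^sub>R w + \<tau> *\<^sub>R x) \<ge> 0"
  shows "\<alpha> *\<^sub>R w + \<tau> *\<^sub>R x \<in> second_order_cone"
proof (rule ccontr)
  assume *: "\<alpha> *\<^sub>R w + \<tau> *\<^sub>R x \<notin> second_order_cone"
  have \<alpha>w: "\<alpha> *\<^sub>R w \<in> second_order_cone"
    using w \<open>\<alpha> \<ge> 0\<close> by (rule second_order_cone_scaleR)
  have "- (\<alpha> *\<^sub>R w + \<tau> *\<^sub>R x) \<in> second_order_cone"
    using nonneg * by (simp only: lorentz_nonneg_iff) blast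
  from second_order_cone_add[OF \<alpha>w this] have "- (\<tau> *\<^sub>R x) \<in> second_order_cone"
    by simp
  then have "lorentz (\<tau> *\<^sub>R x) (\<tau> *\<^sub>R x) \<ge> 0"
    by (simp add: lorentz_nonneg_iff)
  then have "\<tau>\<^sup>2 * lorentz x x \<ge> 0"
    by (simp add: bilinear_lmul[OF bilinear_lorentz] bilinear_rmul[OF bilinear_lorentz] power2_eq_square
        mult.assoc)
  then have "\<tau> = 0"
    using x by (simp add: zero_le_mult_iff)
  then show False
    using * \<alpha>w by simp
qed

section \<open>Forms nonnegative on a half of the second-order cone\<close>

text \<open>Induction on the number of kernel vectors. One with negative \<open>lorentz\<close>
  value is rotated against a vector of positive value, taken from \<open>N\<close> or else
  \<open>w\<close> itself, until one of the two is isotropic. \<open>Q\<close> is nonnegative there,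
  and dropping it keeps the \<open>lorentz\<close> total with one summand fewer.\<close>

lemma sum_form_nonneg_of_split:
  fixes Q :: "real \<times> 'a::real_inner \<Rightarrow> real \<times> 'a \<Rightarrow> real" and \<phi> :: "real \<times> 'a \<Rightarrow> real"
  assumes Q: "bilinear Q" and \<phi>: "linear \<phi>"
    and pos: "\<And>z. z \<in> second_order_cone \<Longrightarrow> \<phi> z \<ge> 0 \<Longrightarrow> Q z z \<ge> 0"
    and "w \<in> second_order_cone" "\<phi> w \<ge> 0" "\<forall>x\<in>#N. \<phi> x = 0"
    and "lorentz w w + (\<Sum>x\<in>#N. lorentz x x) \<ge> 0"
  shows "Q w w + (\<Sum>x\<in>#N. Q x x) \<ge> 0"
  using assms(4-)
proof (induction "size N" arbitrary: w N rule: less_induct)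
  case less
  note w = less.prems(1,2) and N = less.prems(3) and sum = less.prems(4)
  \<comment> \<open>In the kernel of \<open>\<phi>\<close> both sheets are admissible, as
    \<open>Q\<close> takes the same value at \<open>x\<close> and \<open>- x\<close>.\<close>
  have pos_kernel: "Q x x \<ge> 0" if "lorentz x x \<ge> 0" "\<phi> x = 0" for x
    using that pos[of x] pos[of "- x"] Q \<phi>
    by (auto simp: lorentz_nonneg_iff linear_neg bilinear_lneg bilinear_rneg)
  show ?case
  proof (cases "\<forall>x\<in>#N. lorentz x x \<ge> 0")
    case True
    have "(\<Sum>x\<in>#N. Q x x) \<ge> 0"
      using N True pos_kernel sum_mset_mono[of N "\<lambda>_. 0" "\<lambda>x. Q x x"] by simp
    then show ?thesis
      using pos[OF w] by simp
  next
    case False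
    then obtain x where x: "x \<in># N" "lorentz x x < 0"
      by force
    define N1 where "N1 = N - {#x#}"
    have N1: "N = add_mset x N1"
      using x by (simp add: N1_def)
    show ?thesis
    proof (cases "\<exists>y\<in>#N. lorentz y y > 0")
      case True
      then obtain y where y: "y \<in># N" "lorentz y y > 0"
        by blast
      then have "y \<in># N1"
        using x N1 by auto
      define N2 where "N2 = N1 - {#y#}"
      have N2: "N = add_mset x (add_mset y N2)"
        using \<open>y \<in># N1\<close> by (simp add: N2_def N1)
      obtain c s where cs: "c\<^sup>2 + s\<^sup>2 = 1"
        and iso: "lorentz (c *\<^sub>R y + s *\<^sub>R x) (c *\<^sub>R y + s *\<^sub>R x) = 0"
        using rotate_to_isotropic[OF bilinear_lorentz y(2) x(2)] by blast
      have \<phi>0: "\<phi> (c *\<^sub>R y + s *\<^sub>R x) = 0" "\<phi> (s *\<^sub>R y - c *\<^sub>R x) = 0"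
        using N x y \<phi> by (simp_all add: linear_add linear_diff linear_scale)
      have "Q w w + (\<Sum>x\<in>#add_mset (s *\<^sub>R y - c *\<^sub>R x) N2. Q x x) \<ge> 0"
      proof (rule less.hyps)
        show "size (add_mset (s *\<^sub>R y - c *\<^sub>R x) N2) < size N"
          by (simp add: N2)
        show "0 \<le> lorentz w w + (\<Sum>x\<in>#add_mset (s *\<^sub>R y - c *\<^sub>R x) N2. lorentz x x)"
          using sum iso bilinear_rotation[OF bilinear_lorentz cs, of y x] by (simp add: N2)
      qed (use w N N2 \<phi>0 in auto)
      moreover have "Q (c *\<^sub>R y + s *\<^sub>R x) (c *\<^sub>R y + s *\<^sub>R x) \<ge> 0"
        using iso \<phi>0 by (intro pos_kernel) auto
      ultimately show ?thesis
        using bilinear_rotation[OF Q cs, of y x] by (simp add: N2)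
    next
      case False
      \<comment> \<open>With no positive vector in the kernel part, \<open>w\<close> alone must make
        up for \<open>x\<close>, so \<open>w\<close> serves as the partner.\<close>
      then have "(\<Sum>x\<in>#N1. lorentz x x) \<le> 0"
        using sum_mset_mono[of N1 "\<lambda>x. lorentz x x" "\<lambda>_. 0"] by (simp add: N1 not_less)
      then have wx: "lorentz w w + lorentz x x \<ge> 0"
        using sum by (simp add: N1)
      then have "lorentz w w > 0"
        using x by simp
      from rotate_to_isotropic[OF bilinear_lorentz this x(2)]
      obtain c s where cs: "c > 0" "s > 0" "c\<^sup>2 + s\<^sup>2 = 1"
        and iso: "lorentz (c *\<^sub>R w + s *\<^sub>R x) (c *\<^sub>R w + s *\<^sub>R x) = 0"
        by blast
      \<comment> \<open>The other vector of the rotated pair. It inherits the whole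
        \<open>lorentz\<close> value of the pair and contains \<open>w\<close> with coefficient
        \<open>s > 0\<close>, hence it stays on the sheet of \<open>w\<close> and
        \<open>\<phi> w'\<close> stays nonnegative.\<close>
      define w' where "w' = s *\<^sub>R w - c *\<^sub>R x"
      have J_w': "lorentz w' w' = lorentz w w + lorentz x x"
        using iso bilinear_rotation[OF bilinear_lorentz cs(3), of w x] by (simp add: w'_def)
      have "c *\<^sub>R w + s *\<^sub>R x \<in> second_order_cone"
        using second_order_cone_same_sheet[of w c x s] w cs x iso by simp
      moreover have "\<phi> (c *\<^sub>R w + s *\<^sub>R x) \<ge> 0"
        using w N x cs \<phi> by (simp add: linear_add linear_scale)
      ultimately have "Q (c *\<^sub>R w + s *\<^sub>R x) (c *\<^sub>R w + s *\<^sub>R x) \<ge> 0"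
        by (rule pos)
      moreover have "Q w' w' + (\<Sum>x\<in>#N1. Q x x) \<ge> 0"
      proof (rule less.hyps)
        show "w' \<in> second_order_cone"
          using second_order_cone_same_sheet[of w s x "- c"] w cs x wx J_w' by (simp add: w'_def)
        show "\<phi> w' \<ge> 0"
          using w N x cs \<phi> by (simp add: w'_def linear_diff linear_scale)
        show "0 \<le> lorentz w' w' + (\<Sum>x\<in>#N1. lorentz x x)"
          using sum J_w' by (simp add: N1)
      qed (use N N1 in auto)
      ultimately show ?thesis
        using bilinear_rotation[OF Q cs(3), of w x] by (simp add: N1 w'_def)
    qed
  qed
qed

text \<open>The diagonal of this form yields the generators of the separated cone, so one rotation
  treats all three components at once.\<close>

lemma bilinear_triple:
  assumes "bilinear Q" "linear \<phi>"
  shows "bilinear (\<lambda>z w. (lorentz z w, \<phi> z *\<^sub>R w, Q z w :: real))"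
  unfolding bilinear_def
  by (intro conjI allI linearI)
    (simp_all add: bilinear_ladd[OF assms(1)] bilinear_radd[OF assms(1)]
      bilinear_lmul[OF assms(1)] bilinear_rmul[OF assms(1)]
      bilinear_ladd[OF bilinear_lorentz] bilinear_radd[OF bilinear_lorentz]
      bilinear_lmul[OF bilinear_lorentz] bilinear_rmul[OF bilinear_lorentz]
      linear_add[OF assms(2)] linear_scale[OF assms(2)] scaleR_add_left scaleR_add_right)

text \<open>Disjointness of the two sets to be separated. After splitting,
  \<open>v = \<phi> w *\<^sub>R w\<close>, and for \<open>\<phi> w > 0\<close> division brings
  \<open>w\<close> into the cone.\<close>

lemma sum_form_nonneg:
  fixes Q :: "real \<times> 'a::real_inner \<Rightarrow> real \<times> 'a \<Rightarrow> real" and \<phi> :: "real \<times> 'a \<Rightarrow> real"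
  assumes Q: "bilinear Q" and \<phi>: "linear \<phi>"
    and pos: "\<And>z. z \<in> second_order_cone \<Longrightarrow> \<phi> z \<ge> 0 \<Longrightarrow> Q z z \<ge> 0"
    and sum: "(\<Sum>z\<in>#M. (lorentz z z, \<phi> z *\<^sub>R z, Q z z)) = (j, v, q)"
    and "j \<ge> 0" "v \<in> second_order_cone"
  shows "q \<ge> 0"
proof -
  have proj: "(\<Sum>x\<in>#N. (f x, g x, h x)) = (\<Sum>x\<in>#N. f x, \<Sum>x\<in>#N. g x, \<Sum>x\<in>#N. h x)"
    for N :: "(real \<times> 'a) multiset" and f h :: "real \<times> 'a \<Rightarrow> real" and g :: "real \<times> 'a \<Rightarrow> real \<times> 'a"
    by (induction N) (auto simp: zero_prod_def)
  obtain w N where w: "\<phi> w \<ge> 0" and N: "\<forall>x\<in>#N. \<phi> x = 0"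
    and eq: "(j, v, q) = (lorentz w w, \<phi> w *\<^sub>R w, Q w w) + (\<Sum>x\<in>#N. (lorentz x x, \<phi> x *\<^sub>R x, Q x x))"
    using sum_squares_split_kernel[OF bilinear_triple[OF Q \<phi>] \<phi>, of M] unfolding sum by blast
  have "(\<Sum>x\<in>#N. \<phi> x *\<^sub>R x) = 0"
    using N by (auto intro!: sum_mset.neutral)
  with eq have j: "j = lorentz w w + (\<Sum>x\<in>#N. lorentz x x)" and v: "v = \<phi> w *\<^sub>R w"
    and q: "q = Q w w + (\<Sum>x\<in>#N. Q x x)"
    by (simp_all add: proj)
  show ?thesis
  proof (cases "\<phi> w = 0")
    case True
    \<comment> \<open>Here \<open>v = 0\<close> says nothing about where \<open>w\<close> lies, so
      \<open>w\<close> joins the kernel vectors and \<open>0\<close> takes its place in the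
      cone.\<close>
    have "Q 0 0 + (\<Sum>x\<in>#add_mset w N. Q x x) \<ge> 0"
      using True N j \<open>j \<ge> 0\<close> linear_0[OF \<phi>]
      by (intro sum_form_nonneg_of_split[OF Q \<phi> pos])
        (auto simp: second_order_cone_0 bilinear_lzero[OF bilinear_lorentz])
    then show ?thesis
      by (simp add: q bilinear_lzero[OF Q])
  next
    case False
    then have "w = inverse (\<phi> w) *\<^sub>R v"
      by (simp add: v)
    then have "w \<in> second_order_cone"
      using second_order_cone_scaleR[OF \<open>v \<in> second_order_cone\<close>, of "inverse (\<phi> w)"] w by simp
    then show ?thesis
      using sum_form_nonneg_of_split[OF Q \<phi> pos] w N j \<open>j \<ge> 0\<close> by (simp add: q)
  qed
qed

section \<open>Convexity, the dual cone and separation\<close>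

lemma bilinear_sqrt_scale:
  assumes "bilinear B" "u \<ge> 0"
  shows "B (sqrt u *\<^sub>R z) (sqrt u *\<^sub>R z) = u *\<^sub>R B z z"
  using assms(2) by (simp add: bilinear_lmul[OF assms(1)] bilinear_rmul[OF assms(1)])

text \<open>A nonnegative factor is absorbed into each vector as its square root, and addition is
  union of multisets.\<close>

lemma convex_sums_of_squares:
  fixes B :: "'a::real_vector \<Rightarrow> 'a \<Rightarrow> 'b::real_vector"
  assumes B: "bilinear B"
  shows "convex (range (\<lambda>M. \<Sum>z\<in>#M. B z z))"
proof -
  have scale: "\<exists>M'. u *\<^sub>R (\<Sum>z\<in>#M. B z z) = (\<Sum>z\<in>#M'. B z z)" if "u \<ge> 0" for u M
  proof
    show "u *\<^sub>R (\<Sum>z\<in>#M. B z z) = (\<Sum>z\<in>#image_mset (\<lambda>z. sqrt u *\<^sub>R z) M. B z z)"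
      by (induction M) (simp_all add: scaleR_add_right bilinear_sqrt_scale[OF B that])
  qed
  show ?thesis
  proof (rule convexI, clarsimp)
    fix M N :: "'a multiset" and u v :: real
    assume "u \<ge> 0" "v \<ge> 0"
    then obtain M' N' where "u *\<^sub>R (\<Sum>z\<in>#M. B z z) = (\<Sum>z\<in>#M'. B z z)"
      "v *\<^sub>R (\<Sum>z\<in>#N. B z z) = (\<Sum>z\<in>#N'. B z z)"
      using scale by meson
    then show "u *\<^sub>R (\<Sum>z\<in>#M. B z z) + v *\<^sub>R (\<Sum>z\<in>#N. B z z) \<in> range (\<lambda>M. \<Sum>z\<in>#M. B z z)"
      by (intro image_eqI[of _ _ "M' + N'"]) simp_all
  qed
qed

text \<open>Let \<open>r\<close> tend to infinity. This turns the bounds that a hyperplane gives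
  along rays into sign conditions on its coefficients.\<close>

lemma linear_coeff_nonneg:
  fixes k d e :: real
  assumes "\<And>r. r > 0 \<Longrightarrow> e \<le> r * k + d"
  shows "k \<ge> 0"
proof (rule ccontr)
  assume "\<not> k \<ge> 0"
  then have k: "k < 0" by simp
  define r where "r = (\<bar>d\<bar> + \<bar>e\<bar> + 1) / (- k)"
  have "r > 0" "r * k = - (\<bar>d\<bar> + \<bar>e\<bar> + 1)"
    using k by (auto simp: r_def field_simps)
  with assms[of r] show False by simp
qed

text \<open>An interior \<open>z\<close> can be moved a little against \<open>c\<close> without
  leaving the cone; pairing the moved point with \<open>c\<close> gives
  \<open>c \<bullet> z \<ge> \<epsilon> * (c \<bullet> c)\<close>.\<close>

lemma cone_interior_inner_pos:
  fixes c :: "real \<times> 'a::real_inner"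
  assumes dual: "\<forall>w\<in>second_order_cone. c \<bullet> w \<ge> 0" and z: "norm (snd z) < fst z"
    and "c \<noteq> 0"
  shows "c \<bullet> z > 0"
proof -
  \<comment> \<open>The slack is shared equally: the move changes the first component, and the norm
    of the second, by at most \<open>\<epsilon> * norm c\<close> each.\<close>
  define \<epsilon> where "\<epsilon> = (fst z - norm (snd z)) / (2 * norm c)"
  have \<epsilon>: "\<epsilon> > 0" "2 * (\<epsilon> * norm c) = fst z - norm (snd z)"
    using z \<open>c \<noteq> 0\<close> by (simp_all add: \<epsilon>_def)
  have "norm (snd (z - \<epsilon> *\<^sub>R c)) \<le> norm (snd z) + norm (\<epsilon> *\<^sub>R snd c)"
    using norm_triangle_ineq4[of "snd z" "\<epsilon> *\<^sub>R snd c"] by simp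
  also have "\<dots> \<le> norm (snd z) + \<epsilon> * norm c"
    using \<epsilon>(1) norm_snd_le[of "snd c" "fst c"] by (simp add: mult_left_mono)
  also have "\<dots> = fst z - \<epsilon> * norm c"
    using \<epsilon>(2) by simp
  also have "\<dots> \<le> fst z - \<epsilon> * fst c"
    using \<epsilon>(1) norm_fst_le[of "fst c" "snd c"] by (simp add: mult_left_mono)
  finally have "z - \<epsilon> *\<^sub>R c \<in> second_order_cone"
    by (simp add: second_order_cone_def)
  with dual have "c \<bullet> z \<ge> \<epsilon> * (c \<bullet> c)"
    by (auto simp: inner_diff_right)
  then show ?thesis
    using \<epsilon>(1) \<open>c \<noteq> 0\<close> by (smt (verit) inner_gt_zero_iff mult_pos_pos)
qed

text \<open>The multipliers form an exact certificate: conversely, the right-hand side is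
  nonnegative on the cone wherever \<open>\<phi>\<close> is.\<close>

theorem s_lemma_half_second_order_cone:
  fixes Q :: "real \<times> 'a::euclidean_space \<Rightarrow> real \<times> 'a \<Rightarrow> real" and \<phi> :: "real \<times> 'a \<Rightarrow> real"
  assumes Q: "bilinear Q" and \<phi>: "linear \<phi>"
    and pos: "\<And>z. z \<in> second_order_cone \<Longrightarrow> \<phi> z \<ge> 0 \<Longrightarrow> Q z z \<ge> 0"
    and slater: "norm (snd z0) < fst z0" "\<phi> z0 > 0"
  obtains l c where "l \<ge> 0" "\<forall>w\<in>second_order_cone. c \<bullet> w \<ge> 0"
    "\<And>z. Q z z \<ge> l * lorentz z z + (c \<bullet> z) * \<phi> z"
proof -
  define C where "C = range (\<lambda>M. \<Sum>z\<in>#M. (lorentz z z, \<phi> z *\<^sub>R z, Q z z))"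
  define D where "D = {0::real..} \<times> (second_order_cone :: (real \<times> 'a) set) \<times> {..<0::real}"
  have "convex C"
    unfolding C_def by (rule convex_sums_of_squares[OF bilinear_triple[OF Q \<phi>]])
  moreover have "convex D"
    unfolding D_def by (intro convex_Times convex_second_order_cone) auto
  moreover have "C \<noteq> {}"
    by (simp add: C_def)
  moreover have "D \<noteq> {}"
    unfolding D_def using second_order_cone_0 by (auto intro!: exI[of _ "-1::real"])
  moreover have "C \<inter> D = {}"
  proof (rule equals0I)
    fix x assume x: "x \<in> C \<inter> D"
    then obtain M where M: "x = (\<Sum>z\<in>#M. (lorentz z z, \<phi> z *\<^sub>R z, Q z z))"
      unfolding C_def by blast
    from x obtain j v q where jvq: "x = (j, v, q)" "j \<ge> 0" "v \<in> second_order_cone" "q < 0"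
      unfolding D_def by blast
    have "q \<ge> 0"
      using sum_form_nonneg[OF Q \<phi> pos, of M j v q] M jvq by simp
    with jvq show False by simp
  qed
  ultimately obtain p e where "p \<noteq> 0" and C: "\<forall>x\<in>C. p \<bullet> x \<ge> e" and D: "\<forall>x\<in>D. p \<bullet> x \<le> e"
    using separating_hyperplane_sets[of D C] by (metis inf_commute)
  obtain p1 p2 \<rho> where p: "p = (p1, p2, \<rho>)"
    by (metis prod_cases3)
  \<comment> \<open>The functional is bounded above on \<open>D\<close>, so the multipliers are the
    negatives of its first two coefficients.\<close>
  define l c where "l = - p1" and "c = - p2"
  have D': "- l * j - c \<bullet> w + \<rho> * q \<le> e" if "j \<ge> 0" "w \<in> second_order_cone" "q < 0" for j w q
    using D that by (force simp: D_def p l_def c_def)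
  have "0 \<in> C"
    unfolding C_def by (rule image_eqI[of _ _ "{#}"]) auto
  then have "e \<le> 0"
    using C by force
  \<comment> \<open>\<open>C\<close> contains all positive multiples of a single square, so the
    bound \<open>e\<close> improves to \<open>0\<close>.\<close>
  have C': "\<rho> * Q z z - l * lorentz z z - (c \<bullet> z) * \<phi> z \<ge> 0" for z
  proof (rule linear_coeff_nonneg[of e _ 0])
    fix r :: real assume "r > 0"
    then have "r *\<^sub>R (lorentz z z, \<phi> z *\<^sub>R z, Q z z)
        = (\<Sum>z\<in>#{#sqrt r *\<^sub>R z#}. (lorentz z z, \<phi> z *\<^sub>R z, Q z z))"
      using bilinear_sqrt_scale[OF bilinear_triple[OF Q \<phi>], of r z]
      by (simp only: image_mset_single sum_mset.singleton less_imp_le)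
    then have "r *\<^sub>R (lorentz z z, \<phi> z *\<^sub>R z, Q z z) \<in> C"
      unfolding C_def by (rule range_eqI)
    then have "p \<bullet> (r *\<^sub>R (lorentz z z, \<phi> z *\<^sub>R z, Q z z)) \<ge> e"
      using C by blast
    then show "e \<le> r * (\<rho> * Q z z - l * lorentz z z - (c \<bullet> z) * \<phi> z) + 0"
      by (simp add: p l_def c_def algebra_simps)
  qed
  \<comment> \<open>\<open>D\<close> contains rays in its first two coordinates; the third is held
    at \<open>-1\<close> because \<open>0\<close> is excluded there.\<close>
  have "l \<ge> 0"
  proof (rule linear_coeff_nonneg)
    show "- e - \<rho> \<le> r * l + 0" if "r > 0" for r
      using D'[of r 0 "-1"] that by (simp add: second_order_cone_0 algebra_simps)
  qed
  have dual: "\<forall>w\<in>second_order_cone. c \<bullet> w \<ge> 0"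
  proof
    fix w :: "real \<times> 'a" assume w: "w \<in> second_order_cone"
    show "c \<bullet> w \<ge> 0"
    proof (rule linear_coeff_nonneg)
      show "- e - \<rho> \<le> r * (c \<bullet> w) + 0" if "r > 0" for r
        using D'[of 0 "r *\<^sub>R w" "-1"] that second_order_cone_scaleR[OF w, of r] by simp
    qed
  qed
  have "\<rho> \<ge> 0"
    using D'[of 0 0 "-1"] \<open>e \<le> 0\<close> by (simp add: second_order_cone_0)
  \<comment> \<open>Otherwise two nonnegative terms at the Slater point \<open>z0\<close> would have
    sum at most \<open>0\<close>. This forces \<open>c = 0\<close>, then \<open>l = 0\<close>,
    contradicting \<open>p \<noteq> 0\<close>.\<close>
  have "\<rho> \<noteq> 0"
  proof
    assume "\<rho> = 0"
    have "lorentz z0 z0 > 0"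
      using slater(1) by (simp add: lorentz_self power_strict_mono)
    have le: "l * lorentz z0 z0 + (c \<bullet> z0) * \<phi> z0 \<le> 0"
      using C'[of z0] \<open>\<rho> = 0\<close> by simp
    have "c = 0"
    proof (rule ccontr)
      assume "c \<noteq> 0"
      from cone_interior_inner_pos[OF dual slater(1) this]
      have "(c \<bullet> z0) * \<phi> z0 > 0" using slater(2) by simp
      moreover have "l * lorentz z0 z0 \<ge> 0"
        using \<open>l \<ge> 0\<close> \<open>lorentz z0 z0 > 0\<close> by simp
      ultimately show False using le by simp
    qed
    moreover from this have "l = 0"
      using le \<open>l \<ge> 0\<close> \<open>lorentz z0 z0 > 0\<close> by (simp add: mult_le_0_iff)
    ultimately have "p1 = 0" "p2 = 0"
      by (simp_all add: l_def c_def)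
    then show False
      using \<open>p \<noteq> 0\<close> \<open>\<rho> = 0\<close> unfolding p zero_prod_def by blast
  qed
  with \<open>\<rho> \<ge> 0\<close> have "\<rho> > 0" by simp
  show ?thesis
  proof
    show "l / \<rho> \<ge> 0"
      using \<open>l \<ge> 0\<close> \<open>\<rho> > 0\<close> by simp
    show "\<forall>w\<in>second_order_cone. (inverse \<rho> *\<^sub>R c) \<bullet> w \<ge> 0"
      using dual \<open>\<rho> > 0\<close> by simp
    show "Q z z \<ge> l / \<rho> * lorentz z z + ((inverse \<rho> *\<^sub>R c) \<bullet> z) * \<phi> z" for z
      using C'[of z] \<open>\<rho> > 0\<close> by (simp add: field_simps)
  qed
qed

section \<open>Strong duality\<close>

lemma exists_minimizer:
  assumes "feasible_set b \<beta> \<noteq> {}"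
  obtains x where "x \<in> feasible_set b \<beta>" "\<And>y. y \<in> feasible_set b \<beta> \<Longrightarrow> objective A a x \<le> objective A a y"
proof -
  have eq: "feasible_set b \<beta> = cball 0 1 \<inter> {x. b \<bullet> x \<le> \<beta>}"
    by (auto simp: feasible_set_def abs_square_le_1)
  have "compact (feasible_set b \<beta>)"
    unfolding eq by (intro compact_Int_closed compact_cball closed_halfspace_le)
  moreover have "continuous_on (feasible_set b \<beta>) (objective A a)"
    unfolding objective_def by (intro continuous_intros linear_continuous_on_compose[OF continuous_on_id]) auto
  ultimately show ?thesis
    using continuous_attains_inf assms that by metis
qed

text \<open>At a feasible point each multiplier is nonnegative and its constraint nonpositive, so
  both penalty terms can only lower the objective.\<close>

lemma weak_duality:
  assumes "d \<in> dual_feasible_set" "x \<in> feasible_set b \<beta>"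
  shows "dual_function A a b \<beta> d \<le> ereal (objective A a x)"
proof -
  obtain l0 u0 u where d: "d = (l0, u0, u)"
    by (metis prod_cases3)
  have "l0 * ((norm x)\<^sup>2 - 1) \<le> 0"
    using assms by (auto simp: d dual_feasible_set_def feasible_set_def mult_nonneg_nonpos)
  moreover have "(u \<bullet> x - u0) * (b \<bullet> x - \<beta>) \<le> 0"
    using assms by (auto simp: d dual_feasible_set_def multiplier_set_def feasible_set_def mult_nonneg_nonpos)
  ultimately have "lagrangian A a b \<beta> l0 u0 u x \<le> objective A a x"
    by (simp add: lagrangian_def objective_def)
  then show ?thesis
    by (auto simp: d dual_function_def intro: INF_lower2[of x])
qed

text \<open>A single dual point reaches the lower bound \<open>v\<close>; with \<open>v\<close> the
  minimum this gives both a zero gap and dual attainment.\<close>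

lemma exists_multiplier:
  fixes A :: "real^'n^'n"
  assumes slater: "(norm xbar)\<^sup>2 - 1 < 0" "b \<bullet> xbar - \<beta> < 0"
    and v: "\<And>y. y \<in> feasible_set b \<beta> \<Longrightarrow> v \<le> objective A a y"
  obtains d where "d \<in> dual_feasible_set" "ereal v \<le> dual_function A a b \<beta> d"
proof -
  \<comment> \<open>The homogenised objective minus \<open>v\<close>: at
    \<open>z = (t, t *\<^sub>R x)\<close> the value of \<open>Q z z\<close> is
    \<open>t\<^sup>2 * (objective A a x - v)\<close>.\<close>
  define Q where "Q z w = snd z \<bullet> (A *v snd w) + fst z * (a \<bullet> snd w) + fst w * (a \<bullet> snd z) - v * (fst z * fst w)"
    for z w :: "real \<times> (real^'n)"
  define \<phi> where "\<phi> z = \<beta> * fst z - b \<bullet> snd z" for z :: "real \<times> (real^'n)"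
  have Q: "bilinear Q"
    unfolding bilinear_def Q_def
    by (intro conjI allI linearI)
      (simp_all add: algebra_simps inner_add_left inner_add_right matrix_vector_right_distrib
        matrix_vector_mult_scaleR)
  have \<phi>: "linear \<phi>"
    unfolding \<phi>_def by (auto intro!: linearI simp: algebra_simps inner_add_right)
  have pos: "Q z z \<ge> 0" if z: "z \<in> second_order_cone" "\<phi> z \<ge> 0" for z
  proof (cases "fst z = 0")
    \<comment> \<open>The cone meets the hyperplane \<open>fst z = 0\<close> only in the
      origin.\<close>
    case True
    then show ?thesis
      using z by (simp add: second_order_cone_def Q_def)
  next
    case False
    define t x where "t = fst z" and "x = inverse t *\<^sub>R snd z"
    have t: "t > 0"
      using False z norm_ge_zero[of "snd z"] unfolding second_order_cone_def t_def
      by (smt (verit) mem_Collect_eq)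
    then have zt: "z = (t, t *\<^sub>R x)"
      by (simp add: x_def t_def)
    have "norm x \<le> 1"
      using z t by (simp add: zt second_order_cone_def)
    moreover have "t * (b \<bullet> x) \<le> t * \<beta>"
      using z by (simp add: zt \<phi>_def mult.commute)
    ultimately have "x \<in> feasible_set b \<beta>"
      using t by (simp add: feasible_set_def power_le_one)
    then have "t\<^sup>2 * (objective A a x - v) \<ge> 0"
      using v by simp
    moreover have "Q z z = t\<^sup>2 * (objective A a x - v)"
      by (simp add: zt Q_def objective_def power2_eq_square algebra_simps matrix_vector_mult_scaleR)
    ultimately show ?thesis
      by simp
  qed
  have "norm xbar < 1"
    using slater(1) by (simp add: abs_square_less_1)
  then obtain l c where l: "l \<ge> 0" and dual: "\<forall>w\<in>second_order_cone. c \<bullet> w \<ge> 0"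
    and Q_ge: "\<And>z. Q z z \<ge> l * lorentz z z + (c \<bullet> z) * \<phi> z"
    using s_lemma_half_second_order_cone[OF Q \<phi> pos, of "(1, xbar)"] slater(2) by (auto simp: \<phi>_def)
  obtain c0 u where c: "c = (c0, u)"
    by (metis prod.exhaust)
  show ?thesis
  proof
    have "- c0 \<le> u \<bullet> x" if "(norm x)\<^sup>2 \<le> 1" for x
      using bspec[OF dual, of "(1, x)"] that by (simp add: c second_order_cone_def abs_square_le_1)
    then show "(l, - c0, u) \<in> dual_feasible_set"
      using l by (simp add: dual_feasible_set_def multiplier_set_def)
    \<comment> \<open>At \<open>z = (1, x)\<close> the values of \<open>lorentz\<close> and
      \<open>\<phi>\<close> are the negated constraints, so moving both products across yields the
      Lagrangian with \<open>u0 = - c0\<close>.\<close>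
    have "v \<le> lagrangian A a b \<beta> l (- c0) u x" for x
      using Q_ge[of "(1, x)"]
      by (simp add: Q_def \<phi>_def lorentz_self c lagrangian_def algebra_simps)
    then show "ereal v \<le> dual_function A a b \<beta> (l, - c0, u)"
      by (auto simp: dual_function_def intro: INF_greatest)
  qed
qed

theorem theorem2p2:
  fixes A :: "real^'n^'n" and a b :: "real^'n" and \<beta> :: real
  assumes "symmetric_matrix A"
    and "indefinite_matrix A"
    and "\<exists>xbar. (norm xbar)\<^sup>2 - 1 < 0 \<and> b \<bullet> xbar - \<beta> < 0"
  shows "(INF x\<in>feasible_set b \<beta>. ereal (objective A a x))
           = (SUP d\<in>dual_feasible_set. dual_function A a b \<beta> d)
       \<and> (\<exists>x\<in>feasible_set b \<beta>.
             ereal (objective A a x) = (INF y\<in>feasible_set b \<beta>. ereal (objective A a y)))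
       \<and> (\<exists>d\<in>dual_feasible_set.
             dual_function A a b \<beta> d = (SUP e\<in>dual_feasible_set. dual_function A a b \<beta> e))"
proof -
  obtain xbar where slater: "(norm xbar)\<^sup>2 - 1 < 0" "b \<bullet> xbar - \<beta> < 0"
    using assms(3) by blast
  then have "xbar \<in> feasible_set b \<beta>"
    by (simp add: feasible_set_def)
  then obtain x where x: "x \<in> feasible_set b \<beta>"
    and min: "\<And>y. y \<in> feasible_set b \<beta> \<Longrightarrow> objective A a x \<le> objective A a y"
    using exists_minimizer[of b \<beta> A a] by blast
  obtain d where d: "d \<in> dual_feasible_set" "ereal (objective A a x) \<le> dual_function A a b \<beta> d"
    using exists_multiplier[OF slater min] by blast
  have primal: "(INF y\<in>feasible_set b \<beta>. ereal (objective A a y)) = ereal (objective A a x)"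
    using x min by (intro antisym INF_lower INF_greatest) auto
  have "dual_function A a b \<beta> d = ereal (objective A a x)"
    using weak_duality[OF d(1) x] d(2) by (rule antisym)
  moreover have "(SUP e\<in>dual_feasible_set. dual_function A a b \<beta> e) = ereal (objective A a x)"
    using weak_duality[OF _ x] d by (intro antisym SUP_least SUP_upper2[of d]) auto
  ultimately show ?thesis
    using primal x d(1) by metis
qed

end
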